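(* Let $(P,\lambda)$ be a marked poset with all minimal elements of $P$ marked and let $t\in[0,1]^{\tilde P}$. Define $\varphi_t,\psi_t\colon\mathbb{R}^P\to\mathbb{R}^P$ by $$\varphi_t(x)_p=\begin{cases}x_p & p\in P^*,\\ x_p-t_p\max_{q\prec p}x_q & \text{otherwise},\end{cases}\qquad \psi_t(y)_p=\begin{cases}y_p & p\in P^*,\\ y_p+t_p\max_{q\prec p}\psi_t(y)_q & \text{otherwise}\end{cases}$$ (the latter defined recursively). Then $\varphi_t$ and $\psi_t$ are mutually inverse, and $\varphi_t$ restricts to a piecewise-linear bijection from $\mathcal{O}(P,\lambda)$ onto $\mathcal{O}_t(P,\lambda)$.
   Context: A marked poset $(P,\lambda)$ consists of a finite poset $P$ together with an order-preserving map $\lambda\colon P^*\to\mathbb{R}$ on an induced subposet $P^*\subseteq P$; elements of $P^*$ are marked and $\tilde P=P\setminus P^*$. Write $p\prec q$ if $q$ covers $p$. For $t\in[0,1]^{\tilde P}$, $\mathcal{O}_t(P,\lambda)\subseteq\mathbb{R}^P$ is the set of $x$ with $x_a=\lambda(a)$ for $a\in P^*$ and, for every saturated chain $p_0\prec p_1\prec\cdots\prec p_r\prec p$ with $p_0\in P^*$, $p_1,\dots,p_r\in\tilde P$, $p\in P$, $r\ge0$: $(1-t_p)(t_{p_1}\cdots t_{p_r}x_{p_0}+t_{p_2}\cdots t_{p_r}x_{p_1}+\cdots+t_{p_r}x_{p_{r-1}}+x_{p_r})\le x_p$, with $t_p:=0$ for $p\in P^*$. The marked order polyhedron $\mathcal{O}(P,\lambda)=\mathcal{O}_{\mathbf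 0}(P,\lambda)$ is the set of $x$ with $x_a=\lambda(a)$ for $a\in P^*$ and $x_p\le x_q$ whenever $p\prec q$. *)

theory Defs
  imports "HOL-Analysis.Analysis"
begin

text \<open>
  A finite poset is a type of class \<open>finite\<close> and \<open>order\<close>, so that the space of real vectors
  indexed by it is \<open>real ^ 'p\<close>. The set of marked elements is \<open>M\<close>; the marking \<open>lam\<close> is a total
  function of which only the values on \<open>M\<close> are ever used, and the parameter \<open>t\<close> is a total
  function of which only the values off \<open>M\<close> are ever used.
\<close>

definition covered_by :: "'p::order \<Rightarrow> 'p \<Rightarrow> bool"  (infix "\<prec>c" 50) where
  "p \<prec>c q \<longleftrightarrow> p < q \<and> \<not> (\<exists>z. p < z \<and> z < q)"

definition marked_poset :: "'p::{finite,order} set \<Rightarrow> ('p \<Rightarrow> real) \<Rightarrow> bool" where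
  "marked_poset M lam \<longleftrightarrow> mono_on M lam"

definition minimal_elements_marked :: "'p::{finite,order} set \<Rightarrow> bool" where
  "minimal_elements_marked M \<longleftrightarrow> (\<forall>p. (\<nexists>q. q < p) \<longrightarrow> p \<in> M)"

definition param_ext :: "'p set \<Rightarrow> ('p \<Rightarrow> real) \<Rightarrow> 'p \<Rightarrow> real" where
  "param_ext M t p = (if p \<in> M then 0 else t p)"

text \<open>
  The list \<open>ps\<close> is \<open>[p\<^sub>0, \<dots>, p\<^sub>r]\<close>, with \<open>r = length ps - 1 \<ge> 0\<close>.
\<close>

definition marked_chain_to :: "'p::{finite,order} set \<Rightarrow> 'p list \<Rightarrow> 'p \<Rightarrow> bool" where
  "marked_chain_to M ps p \<longleftrightarrow>
     ps \<noteq> [] \<and> hd ps \<in> M \<and> set (tl ps) \<subseteq> - M \<and> successively (\<prec>c) (ps @ [p])"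

definition poset_polyhedron ::
  "'p set \<Rightarrow> ('p \<Rightarrow> real) \<Rightarrow> ('p \<Rightarrow> real) \<Rightarrow> (real ^ 'p::{finite,order}) set" where
  "poset_polyhedron M lam t =
     {x. (\<forall>a\<in>M. x $ a = lam a) \<and>
         (\<forall>ps p. marked_chain_to M ps p \<longrightarrow>
            (1 - param_ext M t p) *
              (\<Sum>i<length ps. (\<Prod>j\<in>{i<..<length ps}. t (ps ! j)) * x $ (ps ! i)) \<le> x $ p)}"

definition marked_order_polyhedron ::
  "'p set \<Rightarrow> ('p \<Rightarrow> real) \<Rightarrow> (real ^ 'p::{finite,order}) set" where
  "marked_order_polyhedron M lam =
     {x. (\<forall>a\<in>M. x $ a = lam a) \<and> (\<forall>p q. p \<prec>c q \<longrightarrow> x $ p \<le> x $ q)}"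

definition phi ::
  "'p set \<Rightarrow> ('p \<Rightarrow> real) \<Rightarrow> real ^ 'p::{finite,order} \<Rightarrow> real ^ 'p::{finite,order}" where
  "phi M t x = (\<chi> p. if p \<in> M then x $ p else x $ p - t p * Max ((\<lambda>q. x $ q) ` {q. q \<prec>c p}))"

function psi_at ::
  "'p set \<Rightarrow> ('p \<Rightarrow> real) \<Rightarrow> real ^ 'p::{finite,order} \<Rightarrow> 'p \<Rightarrow> real" where
  "psi_at M t y p =
     (if p \<in> M then y $ p
      else y $ p + t p * Max ((\<lambda>q. psi_at M t y q) ` {q. q \<prec>c p}))"
  by pat_completeness auto

termination
proof (relation "Wellfounded.measure (\<lambda>(M, t, y, p). card {z. z < p})", goal_cases)
  case 1
  show ?case by simp
next
  case (2 M t y p q)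
  then have "q < p" by (simp add: covered_by_def)
  then have "{z. z < q} \<subset> {z. z < p}" by (auto dest: less_trans)
  then show ?case by (simp add: psubset_card_mono)
qed

declare psi_at.simps [simp del]

definition psi ::
  "'p set \<Rightarrow> ('p \<Rightarrow> real) \<Rightarrow> real ^ 'p::{finite,order} \<Rightarrow> real ^ 'p::{finite,order}" where
  "psi M t y = (\<chi> p. psi_at M t y p)"

text \<open>
  Since the pieces are closed and finite in number, a map that is piecewise linear in this sense
  is continuous on its domain.
\<close>

definition piecewise_linear_on ::
  "'a::euclidean_space set \<Rightarrow> ('a \<Rightarrow> 'b::euclidean_space) \<Rightarrow> bool" where
  "piecewise_linear_on S f \<longleftrightarrow>
     (\<exists>C. finite C \<and> \<Union>C = S \<and>
        (\<forall>K\<in>C. polyhedron K \<and> (\<exists>A b. linear A \<and> (\<forall>x\<in>K. f x = A x + b))))"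

lemma ex_marked_chain_ending_at:
  fixes p :: "'p::{finite,order}"
  assumes "minimal_elements_marked M"
  shows "\<exists>ps. ps \<noteq> [] \<and> hd ps \<in> M \<and> set (tl ps) \<subseteq> - M \<and> successively (\<prec>c) ps \<and> last ps = p"
proof (induction "card {z. z < p}" arbitrary: p rule: less_induct)
  case less
  show ?case
  proof (cases "p \<in> M")
    case True
    then show ?thesis by (intro exI[of _ "[p]"]) simp
  next
    case False
    then have "{q. q < p} \<noteq> {}"
      using assms by (auto simp: minimal_elements_marked_def)
    then obtain q where q: "q < p" "\<And>z. z < p \<Longrightarrow> q \<le> z \<Longrightarrow> q = z"
      using finite_has_maximal[of "{q. q < p}"] by auto
    then have qp: "q \<prec>c p" unfolding covered_by_def using less_imp_le less_irrefl by metis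
    have "{z. z < q} \<subset> {z. z < p}" using q(1) by (auto dest: less_trans)
    then have "card {z. z < q} < card {z. z < p}" by (simp add: psubset_card_mono)
    from less[OF this] obtain ps where
      ps: "ps \<noteq> []" "hd ps \<in> M" "set (tl ps) \<subseteq> - M" "successively (\<prec>c) ps" "last ps = q"
      by blast
    then show ?thesis using qp False
      by (intro exI[of _ "ps @ [p]"]) (auto simp: successively_append_iff)
  qed
qed

lemma marked_order_polyhedron_eq:
  assumes "minimal_elements_marked M"
  shows "marked_order_polyhedron M lam = poset_polyhedron M lam (\<lambda>_. 0)"
proof -
  have sum0: "(\<Sum>i<length ps. (\<Prod>j\<in>{i<..<length ps}. (0::real)) * x $ (ps ! i)) = x $ last ps"
    if "ps \<noteq> []" for ps :: "'a list" and x
  proof -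
    have "(\<Sum>i<length ps. (\<Prod>j\<in>{i<..<length ps}. (0::real)) * x $ (ps ! i))
        = (\<Sum>i<length ps. if i = length ps - 1 then x $ (ps ! i) else 0)"
    proof (intro sum.cong refl)
      fix i assume i: "i \<in> {..<length ps}"
      show "(\<Prod>j\<in>{i<..<length ps}. (0::real)) * x $ (ps ! i)
          = (if i = length ps - 1 then x $ (ps ! i) else 0)"
      proof (cases "i = length ps - 1")
        case True
        then have "{i<..<length ps} = {}" by auto
        then show ?thesis using True by simp
      next
        case False
        then have "length ps - 1 \<in> {i<..<length ps}" using i by auto
        then have "{i<..<length ps} \<noteq> {}" by blast
        then have "card {i<..<length ps} \<noteq> 0" by (simp only: card_eq_0_iff) simp
        then show ?thesis using False by (simp only: prod_constant power_0_left) simp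
      qed
    qed
    also have "\<dots> = x $ last ps" using that by (simp add: last_conv_nth)
    finally show ?thesis .
  qed
  show ?thesis
  proof (intro set_eqI iffI)
    fix x assume "x \<in> marked_order_polyhedron M lam"
    then show "x \<in> poset_polyhedron M lam (\<lambda>_. 0)"
      by (auto simp: marked_order_polyhedron_def poset_polyhedron_def marked_chain_to_def
          param_ext_def sum0 successively_append_iff simp del: prod_constant)
  next
    fix x assume x: "x \<in> poset_polyhedron M lam (\<lambda>_. 0)"
    have "x $ p \<le> x $ q" if pq: "p \<prec>c q" for p q
    proof -
      obtain ps where "ps \<noteq> []" "hd ps \<in> M" "set (tl ps) \<subseteq> - M" "successively (\<prec>c) ps" "last ps = p"
        using ex_marked_chain_ending_at[OF assms] by blast
      then have "marked_chain_to M ps q" "ps \<noteq> []" "last ps = p"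
        using pq by (auto simp: marked_chain_to_def successively_append_iff)
      moreover from this(1) have
        "(\<Sum>i<length ps. (\<Prod>j\<in>{i<..<length ps}. (0::real)) * x $ (ps ! i)) \<le> x $ q"
        using x by (auto simp: poset_polyhedron_def param_ext_def simp del: prod_constant)
      ultimately show ?thesis using sum0[of ps x] by metis
    qed
    then show "x \<in> marked_order_polyhedron M lam"
      using x by (auto simp: marked_order_polyhedron_def poset_polyhedron_def)
  qed
qed

end

theory Submission
  imports Defs
begin

text \<open>
  For a saturated chain \<open>ps\<close> from a marked element up to \<open>q\<close>, let \<open>S(ps)\<close> be the weighted sum in the
  inequalities defining the polyhedron with parameter \<open>t\<close>. If \<open>x = \<psi>\<^sub>t(y)\<close>, the recursions
  \<open>S(ps @ [p]) = t\<^sub>p S(ps) + y\<^sub>p\<close> and \<open>x\<^sub>p = y\<^sub>p + t\<^sub>p max\<^sub>q x\<^sub>q\<close> show that \<open>x\<^sub>q\<close> is the largest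
  value of \<open>S\<close> on the chains ending at \<open>q\<close>; here \<open>t \<ge> 0\<close> enters.
  Hence, for fixed \<open>p\<close>, the chain inequalities for \<open>y\<close> say exactly
  \<open>(1 - t\<^sub>p) max\<^sub>q x\<^sub>q \<le> y\<^sub>p = x\<^sub>p - t\<^sub>p max\<^sub>q x\<^sub>q\<close>, that is \<open>max\<^sub>q x\<^sub>q \<le> x\<^sub>p\<close>. The map \<open>\<phi>\<^sub>t\<close> is
  linear wherever a choice of maximising lower covers is fixed.
\<close>

section \<open>Marked chains and their weighted sums\<close>

definition chain_sum :: "('p \<Rightarrow> real) \<Rightarrow> real ^ 'p::finite \<Rightarrow> 'p list \<Rightarrow> real" where
  "chain_sum t y ps = (\<Sum>i<length ps. (\<Prod>j\<in>{i<..<length ps}. t (ps ! j)) * y $ (ps ! i))"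

text \<open>Unlike in \<open>marked_chain_to\<close>, the endpoint belongs to the list, so chains
  grow by appending a cover and support induction. A marked endpoint forces a singleton.\<close>

definition marked_chain_ending_at :: "'p::{finite,order} set \<Rightarrow> 'p list \<Rightarrow> 'p \<Rightarrow> bool" where
  "marked_chain_ending_at M ps p \<longleftrightarrow>
     ps \<noteq> [] \<and> hd ps \<in> M \<and> set (tl ps) \<subseteq> - M \<and> successively (\<prec>c) ps \<and> last ps = p"

lemma marked_chain_to_iff:
  "marked_chain_to M ps p \<longleftrightarrow> (\<exists>q. marked_chain_ending_at M ps q \<and> q \<prec>c p)"
  by (auto simp: marked_chain_to_def marked_chain_ending_at_def successively_append_iff)

lemma marked_chain_ending_at_snoc:
  "marked_chain_ending_at M (ps @ [p]) p \<longleftrightarrow>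
     (if ps = [] then p \<in> M else p \<notin> M \<and> (\<exists>q. marked_chain_ending_at M ps q \<and> q \<prec>c p))"
  by (auto simp: marked_chain_ending_at_def successively_append_iff)

lemma poset_polyhedron_iff:
  "y \<in> poset_polyhedron M lam t \<longleftrightarrow>
     (\<forall>a\<in>M. y $ a = lam a) \<and>
     (\<forall>ps q p. marked_chain_ending_at M ps q \<longrightarrow> q \<prec>c p \<longrightarrow>
        (1 - param_ext M t p) * chain_sum t y ps \<le> y $ p)"
  by (auto simp: poset_polyhedron_def chain_sum_def marked_chain_to_iff)

lemma chain_sum_singleton [simp]: "chain_sum t y [p] = y $ p"
  by (simp add: chain_sum_def)

text \<open>Each old weight gains the factor \<open>t p\<close>, while the new last term has an
  empty product as its weight.\<close>

lemma chain_sum_snoc: "chain_sum t y (ps @ [p]) = t p * chain_sum t y ps + y $ p"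
proof -
  have "(\<Prod>j\<in>{i<..<Suc (length ps)}. t ((ps @ [p]) ! j)) * y $ ((ps @ [p]) ! i)
      = t p * ((\<Prod>j\<in>{i<..<length ps}. t (ps ! j)) * y $ (ps ! i))"
    if "i < length ps" for i
  proof -
    have "{i<..<Suc (length ps)} = insert (length ps) {i<..<length ps}"
      using that by auto
    moreover have "(\<Prod>j\<in>{i<..<length ps}. t ((ps @ [p]) ! j)) = (\<Prod>j\<in>{i<..<length ps}. t (ps ! j))"
      by (rule prod.cong) (auto simp: nth_append)
    ultimately show ?thesis using that by (simp add: nth_append)
  qed
  moreover have "{length ps<..<Suc (length ps)} = {}" by auto
  ultimately show ?thesis
    by (simp add: chain_sum_def sum_distrib_left)
qed

lemma covered_by_card_less:
  fixes p q :: "'p::{finite,order}"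
  assumes "q \<prec>c p"
  shows "card {z. z < q} < card {z. z < p}"
proof -
  have "{z. z < q} \<subset> {z. z < p}"
    using assms by (auto simp: covered_by_def dest: less_trans)
  then show ?thesis by (simp add: psubset_card_mono)
qed

text \<open>A marked chain ending at an unmarked \<open>p\<close> is not a singleton, and its
  penultimate element is covered by \<open>p\<close>. This makes the maxima over lower covers
  meaningful.\<close>

lemma ex_lower_cover:
  fixes p :: "'p::{finite,order}"
  assumes "minimal_elements_marked M" "p \<notin> M"
  shows "\<exists>q. q \<prec>c p"
proof -
  obtain ps where ps: "marked_chain_ending_at M ps p"
    using ex_marked_chain_ending_at[OF assms(1)] unfolding marked_chain_ending_at_def by blast
  then have "ps = butlast ps @ [p]"
    by (auto simp: marked_chain_ending_at_def)
  then show ?thesis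
    using ps assms(2) marked_chain_ending_at_snoc[of M "butlast ps" p] by (metis (full_types))
qed

lemma obtain_max_lower_cover:
  fixes p :: "'p::{finite,order}" and f :: "'p \<Rightarrow> real"
  assumes "minimal_elements_marked M" "p \<notin> M"
  obtains q where "q \<prec>c p" "Max (f ` {q. q \<prec>c p}) = f q" "\<And>r. r \<prec>c p \<Longrightarrow> f r \<le> f q"
proof -
  have "Max (f ` {q. q \<prec>c p}) \<in> f ` {q. q \<prec>c p}"
    using ex_lower_cover[OF assms] by (intro Max_in) auto
  then obtain q where q: "q \<prec>c p" "Max (f ` {q. q \<prec>c p}) = f q" by auto
  have "f r \<le> f q" if "r \<prec>c p" for r
    using that unfolding q(2)[symmetric] by (intro Max_ge) auto
  with q that show ?thesis by blast
qed

section \<open>The inverse maps and the transfer of inequalities\<close>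

lemma phi_marked [simp]: "p \<in> M \<Longrightarrow> phi M t x $ p = x $ p"
  by (simp add: phi_def)

lemma phi_unmarked:
  "p \<notin> M \<Longrightarrow> phi M t x $ p = x $ p - t p * Max ((\<lambda>q. x $ q) ` {q. q \<prec>c p})"
  by (simp add: phi_def)

text \<open>Once \<open>psi\<close> has recovered \<open>x\<close> on all lower covers of
  \<open>p\<close>, it adds back exactly the term that \<open>phi\<close> subtracted.\<close>

lemma psi_phi: "psi M t (phi M t x) = x"
proof -
  have "psi_at M t (phi M t x) p = x $ p" for p
  proof (induction "card {z. z < p}" arbitrary: p rule: less_induct)
    case less
    then have "psi_at M t (phi M t x) ` {q. q \<prec>c p} = (\<lambda>q. x $ q) ` {q. q \<prec>c p}"
      by (intro image_cong refl) (simp add: covered_by_card_less)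
    then show ?case
      by (subst psi_at.simps) (simp add: phi_unmarked)
  qed
  then show ?thesis by (simp add: psi_def vec_eq_iff)
qed

text \<open>One unfolding of the recursion for \<open>psi\<close> suffices: \<open>phi\<close>
  subtracts the term just added.\<close>

lemma phi_psi: "phi M t (psi M t y) = y"
proof -
  have "phi M t (psi M t y) $ p = y $ p" for p
    using psi_at.simps[of M t y p] by (simp add: phi_def psi_def)
  then show ?thesis by (simp add: vec_eq_iff)
qed

lemma chain_sum_phi_le:
  fixes x :: "real ^ 'p::{finite,order}"
  assumes "\<And>p. p \<notin> M \<Longrightarrow> 0 \<le> t p"
    and "marked_chain_ending_at M ps p"
  shows "chain_sum t (phi M t x) ps \<le> x $ p"
  using assms(2)
proof (induction ps arbitrary: p rule: rev_induct)
  case Nil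
  then show ?case by (simp add: marked_chain_ending_at_def)
next
  case (snoc r ps)
  have [simp]: "r = p" using snoc.prems by (simp add: marked_chain_ending_at_def)
  show ?case
  proof (cases "ps = []")
    case True
    then show ?thesis using snoc.prems by (simp add: marked_chain_ending_at_def)
  next
    case False
    then obtain q where q: "marked_chain_ending_at M ps q" "q \<prec>c p" and p: "p \<notin> M"
      using snoc.prems by (auto simp: marked_chain_ending_at_snoc)
    have "x $ q \<le> Max ((\<lambda>q. x $ q) ` {q. q \<prec>c p})"
      using q by (intro Max_ge) auto
    with snoc.IH[OF q(1)]
    have "chain_sum t (phi M t x) ps \<le> Max ((\<lambda>q. x $ q) ` {q. q \<prec>c p})" by linarith
    then have "t p * chain_sum t (phi M t x) ps \<le> t p * Max ((\<lambda>q. x $ q) ` {q. q \<prec>c p})"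
      using assms(1)[OF p] by (rule mult_left_mono)
    then show ?thesis using p by (simp add: chain_sum_snoc phi_unmarked)
  qed
qed

text \<open>Descending from \<open>p\<close> through maximising lower covers until a marked element
  is reached gives a chain with equality at every step.\<close>

lemma chain_sum_phi_attained:
  fixes x :: "real ^ 'p::{finite,order}"
  assumes "minimal_elements_marked M"
  shows "\<exists>ps. marked_chain_ending_at M ps p \<and> chain_sum t (phi M t x) ps = x $ p"
proof (induction "card {z. z < p}" arbitrary: p rule: less_induct)
  case less
  show ?case
  proof (cases "p \<in> M")
    case True
    then show ?thesis
      by (intro exI[of _ "[p]"]) (simp add: marked_chain_ending_at_def)
  next
    case False
    then obtain q where q: "q \<prec>c p" "Max ((\<lambda>q. x $ q) ` {q. q \<prec>c p}) = x $ q"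
      using obtain_max_lower_cover[OF assms] by metis
    then obtain ps where ps: "marked_chain_ending_at M ps q"
      "chain_sum t (phi M t x) ps = x $ q"
      using less covered_by_card_less by blast
    then have "marked_chain_ending_at M (ps @ [p]) p"
      using q False by (auto simp: marked_chain_ending_at_snoc) (simp add: marked_chain_ending_at_def)
    moreover have "chain_sum t (phi M t x) (ps @ [p]) = x $ p"
      using ps q False by (simp add: chain_sum_snoc phi_unmarked)
    ultimately show ?thesis by blast
  qed
qed

text \<open>As an equivalence for all \<open>x\<close>, this yields both inclusions needed for the
  bijection, the second by taking \<open>x = psi M t y\<close>.\<close>

lemma phi_in_poset_polyhedron_iff:
  fixes x :: "real ^ 'p::{finite,order}"
  assumes "minimal_elements_marked M"
    and t: "\<And>p. p \<notin> M \<Longrightarrow> 0 \<le> t p \<and> t p \<le> 1"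
  shows "phi M t x \<in> poset_polyhedron M lam t \<longleftrightarrow> x \<in> marked_order_polyhedron M lam"
proof
  assume x: "x \<in> marked_order_polyhedron M lam"
  have "(1 - param_ext M t p) * chain_sum t (phi M t x) ps \<le> phi M t x $ p"
    if ps: "marked_chain_ending_at M ps q" and qp: "q \<prec>c p" for ps q p
  proof -
    have S: "chain_sum t (phi M t x) ps \<le> x $ q"
      using chain_sum_phi_le ps t by blast
    show ?thesis
    proof (cases "p \<in> M")
      case True
      moreover have "x $ q \<le> x $ p"
        using x qp by (simp add: marked_order_polyhedron_def)
      ultimately show ?thesis using S by (simp add: param_ext_def)
    next
      case False
      obtain m where m: "m \<prec>c p" "Max ((\<lambda>q. x $ q) ` {q. q \<prec>c p}) = x $ m" "x $ q \<le> x $ m"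
        using obtain_max_lower_cover[OF assms(1) False] qp by metis
      \<comment> \<open>Here \<open>t p \<le> 1\<close> enters: the factor is nonnegative, so the
        chain sum may be replaced by the larger \<open>x $ m\<close>.\<close>
      have "(1 - t p) * chain_sum t (phi M t x) ps \<le> (1 - t p) * x $ m"
        using S m t[OF False] by (intro mult_left_mono) auto
      also have "\<dots> \<le> x $ p - t p * x $ m"
        using x m by (simp add: marked_order_polyhedron_def algebra_simps)
      finally show ?thesis using m False by (simp add: param_ext_def phi_unmarked)
    qed
  qed
  with x show "phi M t x \<in> poset_polyhedron M lam t"
    by (auto simp: poset_polyhedron_iff marked_order_polyhedron_def)
next
  assume y: "phi M t x \<in> poset_polyhedron M lam t"
  \<comment> \<open>Choosing the chain that attains \<open>x $ q\<close> turns a chain inequality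
    into one between coordinates.\<close>
  have ineq: "(1 - param_ext M t p) * x $ q \<le> phi M t x $ p" if "q \<prec>c p" for p q
    using chain_sum_phi_attained[OF assms(1), of q t x] y that
    unfolding poset_polyhedron_iff by metis
  have "x $ q \<le> x $ p" if qp: "q \<prec>c p" for p q
  proof (cases "p \<in> M")
    case True
    then show ?thesis using ineq[OF qp] by (simp add: param_ext_def)
  next
    case False
    obtain m where m: "m \<prec>c p" "Max ((\<lambda>q. x $ q) ` {q. q \<prec>c p}) = x $ m" "x $ q \<le> x $ m"
      using obtain_max_lower_cover[OF assms(1) False] qp by metis
    \<comment> \<open>At the maximising cover, \<open>t p * x $ m\<close> is subtracted on both
      sides and cancels.\<close>
    have "x $ m \<le> x $ p"
      using ineq[OF m(1)] m(2) False by (simp add: param_ext_def phi_unmarked algebra_simps)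
    then show ?thesis using m(3) by simp
  qed
  then show "x \<in> marked_order_polyhedron M lam"
    using y by (auto simp: marked_order_polyhedron_def poset_polyhedron_iff)
qed

section \<open>Polyhedral pieces and piecewise linearity\<close>

lemma polyhedron_component_le:
  fixes p q :: "'p::finite"
  shows "polyhedron {x :: real ^ 'p. x $ p \<le> x $ q}"
proof -
  have "{x :: real ^ 'p. x $ p \<le> x $ q} = {x. (axis p 1 - axis q 1) \<bullet> x \<le> 0}"
    by (simp add: inner_diff_left inner_axis')
  then show ?thesis by (simp add: polyhedron_halfspace_le)
qed

lemma polyhedron_component_eq:
  fixes p :: "'p::finite"
  shows "polyhedron {x :: real ^ 'p. x $ p = c}"
proof -
  have "{x :: real ^ 'p. x $ p = c} = {x. axis p 1 \<bullet> x = c}"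
    by (simp add: inner_axis')
  then show ?thesis by (simp add: polyhedron_hyperplane)
qed

lemma polyhedron_components_le:
  fixes R :: "('p::finite \<times> 'p) set"
  shows "polyhedron {x :: real ^ 'p. \<forall>(p, q)\<in>R. x $ p \<le> x $ q}"
proof -
  have "{x :: real ^ 'p. \<forall>(p, q)\<in>R. x $ p \<le> x $ q} = \<Inter>((\<lambda>(p, q). {x. x $ p \<le> x $ q}) ` R)"
    by auto
  also have "polyhedron \<dots>"
    by (rule polyhedron_Inter) (auto simp: polyhedron_component_le)
  finally show ?thesis .
qed

lemma polyhedron_marked_order_polyhedron: "polyhedron (marked_order_polyhedron M lam)"
proof -
  have "marked_order_polyhedron M lam =
      \<Inter>((\<lambda>a. {x. x $ a = lam a}) ` M) \<inter> {x. \<forall>(p, q)\<in>{(p, q). p \<prec>c q}. x $ p \<le> x $ q}"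
    by (auto simp: marked_order_polyhedron_def)
  also have "polyhedron \<dots>"
    by (intro polyhedron_Int polyhedron_Inter polyhedron_components_le)
      (auto simp: polyhedron_component_eq)
  finally show ?thesis .
qed

lemma piecewise_linear_phi:
  fixes M :: "'p::{finite,order} set" and S :: "(real ^ 'p::{finite,order}) set"
  assumes "minimal_elements_marked M" and "polyhedron S"
  shows "piecewise_linear_on S (phi M t)"
proof -
  \<comment> \<open>A piece \<open>K s\<close> consists of the points of \<open>S\<close> at which
    the chosen cover \<open>s p\<close> attains the maximum below every unmarked \<open>p\<close>;
    there \<open>phi\<close> agrees with the linear map \<open>A s\<close>.\<close>
  define R where "R s = {(q, s p) | p q. p \<notin> M \<and> q \<prec>c p}" for s :: "'p \<Rightarrow> 'p"
  define K where "K s = S \<inter> {x. \<forall>(p, q)\<in>R s. x $ p \<le> x $ q}" for s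
  define Ch where "Ch = {s. \<forall>p. p \<notin> M \<longrightarrow> s p \<prec>c p}"
  define A :: "('p \<Rightarrow> 'p) \<Rightarrow> real ^ 'p::{finite,order} \<Rightarrow> real ^ 'p::{finite,order}"
    where "A s x = (\<chi> p. if p \<in> M then x $ p else x $ p - t p * x $ s p)" for s x
  have "\<Union>(K ` Ch) = S"
  proof
    show "S \<subseteq> \<Union>(K ` Ch)"
    proof
      fix x assume "x \<in> S"
      have "\<exists>m. p \<notin> M \<longrightarrow> m \<prec>c p \<and> (\<forall>q. q \<prec>c p \<longrightarrow> x $ q \<le> x $ m)" for p
        using obtain_max_lower_cover[OF assms(1), of p "\<lambda>q. x $ q"] by metis
      then obtain s where "\<And>p. p \<notin> M \<Longrightarrow> s p \<prec>c p \<and> (\<forall>q. q \<prec>c p \<longrightarrow> x $ q \<le> x $ s p)"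
        by metis
      then have "s \<in> Ch" "x \<in> K s"
        using \<open>x \<in> S\<close> by (auto simp: Ch_def K_def R_def)
      then show "x \<in> \<Union>(K ` Ch)" by blast
    qed
  qed (auto simp: K_def)
  moreover have "polyhedron (K s)" for s
    unfolding K_def by (intro polyhedron_Int assms polyhedron_components_le)
  moreover have "linear (A s)" for s
    by (rule linearI) (simp_all add: A_def vec_eq_iff algebra_simps)
  moreover have "phi M t x = A s x" if "s \<in> Ch" "x \<in> K s" for s x
  proof -
    have "Max ((\<lambda>q. x $ q) ` {q. q \<prec>c p}) = x $ s p" if "p \<notin> M" for p
      using that \<open>s \<in> Ch\<close> \<open>x \<in> K s\<close>
      by (intro Max_eqI) (auto simp: Ch_def K_def R_def)
    then show ?thesis by (simp add: phi_def A_def vec_eq_iff)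
  qed
  ultimately show ?thesis
    unfolding piecewise_linear_on_def
    \<comment> \<open>There are finitely many pieces because \<open>s\<close> ranges over functions
      on a finite type; the translation part is 0.\<close>
    by (intro exI[of _ "K ` Ch"]) (auto intro!: exI[of _ "A _"] exI[of _ 0])
qed

theorem theorem2p1:
  fixes M :: "'p::{finite,order} set" and lam t :: "'p \<Rightarrow> real"
  assumes "marked_poset M lam"
    and "minimal_elements_marked M"
    and "\<And>p. p \<notin> M \<Longrightarrow> 0 \<le> t p \<and> t p \<le> 1"
  shows "(\<forall>x. psi M t (phi M t x) = x) \<and>
         (\<forall>y. phi M t (psi M t y) = y) \<and>
         bij_betw (phi M t) (marked_order_polyhedron M lam) (poset_polyhedron M lam t) \<and>
         piecewise_linear_on (marked_order_polyhedron M lam) (phi M t)"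
proof (intro conjI allI)
  have iff: "phi M t x \<in> poset_polyhedron M lam t \<longleftrightarrow> x \<in> marked_order_polyhedron M lam" for x
    using assms(2,3) by (rule phi_in_poset_polyhedron_iff)
  show "bij_betw (phi M t) (marked_order_polyhedron M lam) (poset_polyhedron M lam t)"
  proof (rule bij_betw_byWitness[where f' = "psi M t"])
    show "phi M t ` marked_order_polyhedron M lam \<subseteq> poset_polyhedron M lam t"
      by (auto simp: iff)
    show "psi M t ` poset_polyhedron M lam t \<subseteq> marked_order_polyhedron M lam"
      by (auto simp: iff[symmetric] phi_psi)
  qed (simp_all add: psi_phi phi_psi)
qed (simp_all add: psi_phi phi_psi piecewise_linear_phi assms polyhedron_marked_order_polyhedron)

end
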